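(* Let $G=(A\cup B,E)$ be a marriage instance and let $C\subseteq A$ be a set of critical nodes. An edge $e\in E$ belongs to a popular feasible matching of $G$ if and only if $e$ belongs to a minimum size popular feasible matching of $G$ or to a dominant feasible matching of $G$.
   Context: A marriage instance is a bipartite graph $G=(A\cup B,E)$, $A$ a set of men and $B$ a set of women, where every vertex has a strict preference ordering over its neighbours; every vertex prefers being matched to any neighbour over being unmatched. For matchings $M,N$, a vertex $v$ prefers $N$ to $M$ if $v$ is matched in $N$ and unmatched in $M$, or is matched in both and prefers $N(v)$ to $M(v)$; $\phi(N,M)$ is the number of vertices preferring $N$ to $M$. A matching is feasible if it matches every vertex of $C$. A popular feasible matching is a feasible matching $M$ with $\phi(N,M)\le \phi(M,N)$ for every feasible matching $N$. A minimum size popular feasible matching is a popular feasible matching of minimum cardinality among all popular feasible matchings. A dominant feasible matching is a popular feasible matching $M$ such that $\phi(M,N)>\phi(N,M)$ for every feasible matching $N$ with $|N|>|M|$. *)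

theory Defs
  imports Main
begin

record 'v marriage =
  men :: "'v set"
  women :: "'v set"
  edges :: "'v set set"
  pref :: "'v \<Rightarrow> 'v rel"

definition neighbours :: "'v marriage \<Rightarrow> 'v \<Rightarrow> 'v set" where
  "neighbours G v = {u. {v, u} \<in> edges G}"

text \<open>
  A pair \<open>(x, y) \<in> pref G v\<close> means that \<open>v\<close> strictly prefers \<open>x\<close> to \<open>y\<close>.
\<close>

definition marriage_instance :: "'v marriage \<Rightarrow> bool" where
  "marriage_instance G \<longleftrightarrow>
     finite (men G) \<and> finite (women G) \<and> men G \<inter> women G = {} \<and>
     edges G \<subseteq> {{a, b} | a b. a \<in> men G \<and> b \<in> women G} \<and>
     (\<forall>v \<in> men G \<union> women G.
        pref G v \<subseteq> neighbours G v \<times> neighbours G v \<and>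
        strict_linear_order_on (neighbours G v) (pref G v))"

definition is_matching :: "'v marriage \<Rightarrow> 'v set set \<Rightarrow> bool" where
  "is_matching G M \<longleftrightarrow> M \<subseteq> edges G \<and> pairwise disjnt M"

definition matched :: "'v set set \<Rightarrow> 'v \<Rightarrow> bool" where
  "matched M v \<longleftrightarrow> v \<in> \<Union>M"

text \<open>
  \<open>partner M v\<close> is meaningful only if \<open>M\<close> is a matching that matches \<open>v\<close>.
\<close>

definition partner :: "'v set set \<Rightarrow> 'v \<Rightarrow> 'v" where
  "partner M v = (THE u. {v, u} \<in> M)"

definition prefers :: "'v marriage \<Rightarrow> 'v \<Rightarrow> 'v set set \<Rightarrow> 'v set set \<Rightarrow> bool" where
  "prefers G v N M \<longleftrightarrow>
     matched N v \<and> \<not> matched M v \<or>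
     matched N v \<and> matched M v \<and> (partner N v, partner M v) \<in> pref G v"

definition phi :: "'v marriage \<Rightarrow> 'v set set \<Rightarrow> 'v set set \<Rightarrow> nat" where
  "phi G N M = card {v \<in> men G \<union> women G. prefers G v N M}"

definition feasible_matching :: "'v marriage \<Rightarrow> 'v set \<Rightarrow> 'v set set \<Rightarrow> bool" where
  "feasible_matching G C M \<longleftrightarrow> is_matching G M \<and> (\<forall>v \<in> C. matched M v)"

definition popular_feasible :: "'v marriage \<Rightarrow> 'v set \<Rightarrow> 'v set set \<Rightarrow> bool" where
  "popular_feasible G C M \<longleftrightarrow>
     feasible_matching G C M \<and>
     (\<forall>N. feasible_matching G C N \<longrightarrow> phi G N M \<le> phi G M N)"

definition min_size_popular_feasible :: "'v marriage \<Rightarrow> 'v set \<Rightarrow> 'v set set \<Rightarrow> bool" where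
  "min_size_popular_feasible G C M \<longleftrightarrow>
     popular_feasible G C M \<and>
     (\<forall>N. popular_feasible G C N \<longrightarrow> card M \<le> card N)"

definition dominant_feasible :: "'v marriage \<Rightarrow> 'v set \<Rightarrow> 'v set set \<Rightarrow> bool" where
  "dominant_feasible G C M \<longleftrightarrow>
     popular_feasible G C M \<and>
     (\<forall>N. feasible_matching G C N \<and> card N > card M \<longrightarrow> phi G M N > phi G N M)"

end

theory Submission
  imports Defs "HOL-Combinatorics.Cycles"
begin

text \<open>A feasible matching is popular iff linear programming duality provides integral values
  \<open>\<alpha>\<close> on the vertices that dominate the votes on every edge, are at least \<open>-1\<close> off \<open>C\<close> and
  cancel on matching edges. If all values are even, tightness makes every popular feasible matching
  cover all vertices that the given one covers, so the latter has minimum size; if the values are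
  odd on all matched vertices, a similar parity argument gives dominance. In general both ends of a
  matching edge have values of the same parity, and it suffices to keep the edges of one parity and
  to rematch the other vertices with values of that parity. The new edges come from a stable
  matching in a multigraph with one copy of an edge for each possible value, where men prefer small
  and women large values to partners; truncating the preference lists according to the old matching
  makes the two parts fit together.\<close>

section \<open>Stable matchings in multigraphs\<close>

lemma finite_top_exists:
  assumes "finite Y" "Y \<noteq> {}"
    and "\<And>x y. x \<in> Y \<Longrightarrow> y \<in> Y \<Longrightarrow> x = y \<or> P x y \<or> P y x"
    and "\<And>x y z. x \<in> Y \<Longrightarrow> y \<in> Y \<Longrightarrow> z \<in> Y \<Longrightarrow> P x y \<Longrightarrow> P y z \<Longrightarrow> P x z"
  shows "\<exists>x\<in>Y. \<forall>y\<in>Y. x = y \<or> P x y"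
  using assms
proof (induction Y rule: finite_ne_induct)
  case (singleton x)
  show ?case by simp
next
  case (insert z Y)
  have "\<exists>x\<in>Y. \<forall>y\<in>Y. x = y \<or> P x y"
    by (rule insert.IH) (use insert.prems in \<open>blast+\<close>)
  then obtain x where x: "x \<in> Y" "\<forall>y\<in>Y. x = y \<or> P x y"
    by blast
  show ?case
  proof (cases "P x z")
    case True
    then show ?thesis using x by blast
  next
    case False
    then have "z = x \<or> P z x" using insert.prems(1)[of x z] x(1) by auto
    then have "\<forall>y\<in>Y. z = y \<or> P z y" using x insert.prems(2)[of z x] by (metis insert_iff)
    then show ?thesis by blast
  qed
qed

text \<open>Deferred acceptance as an induction on the edge set; \<open>f\<close> and
  \<open>g\<close> give the man and the woman of an edge, so parallel edges are allowed. If the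
  favourite edges of all men end at different women, they are stable. Otherwise a woman refuses the
  worse of two favourites, and that edge is deleted.\<close>

lemma stable_matching_exists:
  assumes "finite X"
    and mtotal: "\<And>x y. x \<in> X \<Longrightarrow> y \<in> X \<Longrightarrow> f x = f y \<Longrightarrow> x = y \<or> P x y \<or> P y x"
    and mtrans: "\<And>x y z. x \<in> X \<Longrightarrow> y \<in> X \<Longrightarrow> z \<in> X \<Longrightarrow> f x = f y \<Longrightarrow> f y = f z \<Longrightarrow>
                  P x y \<Longrightarrow> P y z \<Longrightarrow> P x z"
    and mirrefl: "\<And>x. x \<in> X \<Longrightarrow> \<not> P x x"
    and wtotal: "\<And>x y. x \<in> X \<Longrightarrow> y \<in> X \<Longrightarrow> g x = g y \<Longrightarrow> x = y \<or> R x y \<or> R y x"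
    and wtrans: "\<And>x y z. x \<in> X \<Longrightarrow> y \<in> X \<Longrightarrow> z \<in> X \<Longrightarrow> g x = g y \<Longrightarrow> g y = g z \<Longrightarrow>
                  R x y \<Longrightarrow> R y z \<Longrightarrow> R x z"
  shows "\<exists>S \<subseteq> X. inj_on f S \<and> inj_on g S \<and>
    (\<forall>x\<in>X. (\<exists>y\<in>S. f y = f x \<and> (y = x \<or> P y x)) \<or> (\<exists>y\<in>S. g y = g x \<and> (y = x \<or> R y x)))"
  using assms
proof (induction X rule: finite_psubset_induct)
  case (psubset X)
  define T where "T = {x \<in> X. \<forall>y\<in>X. f y = f x \<longrightarrow> x = y \<or> P x y}"
  have top: "\<exists>y\<in>T. f y = f x" if "x \<in> X" for x
  proof -
    have "\<exists>y\<in>{y\<in>X. f y = f x}. \<forall>z\<in>{y\<in>X. f y = f x}. y = z \<or> P y z"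
    proof (rule finite_top_exists)
      fix u v w assume "u \<in> {y \<in> X. f y = f x}" "v \<in> {y \<in> X. f y = f x}" "w \<in> {y \<in> X. f y = f x}"
        "P u v" "P v w"
      then show "P u w" using psubset.prems(2)[of u v w] by simp
    next
      show "finite {y \<in> X. f y = f x}" using psubset.hyps by simp
      show "{y \<in> X. f y = f x} \<noteq> {}" using that by blast
      show "u = v \<or> P u v \<or> P v u" if "u \<in> {y \<in> X. f y = f x}" "v \<in> {y \<in> X. f y = f x}" for u v
        using psubset.prems(1)[of u v] that by simp
    qed
    then show ?thesis unfolding T_def by fastforce
  qed
  show ?case
  proof (cases "inj_on g T")
    case True
    obtain S where S: "S \<subseteq> T" "inj_on f S" "f ` S = f ` T"
      using subset_image_inj[of "f ` T" f T] by auto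
    have "\<exists>y\<in>S. f y = f x \<and> (y = x \<or> P y x)" if x: "x \<in> X" for x
    proof -
      obtain y where y: "y \<in> S" "f y = f x" using top[OF x] S(3) by (metis imageE imageI)
      then have "y = x \<or> P y x" using S(1) x by (force simp: T_def)
      then show ?thesis using y by blast
    qed
    moreover have "inj_on g S" using True S(1) inj_on_subset by blast
    moreover have "S \<subseteq> X" using S(1) by (auto simp: T_def)
    ultimately show ?thesis using S(2) by blast
  next
    case False
    then obtain x y where xy: "x \<in> T" "y \<in> T" "g x = g y" "x \<noteq> y" "R x y"
      unfolding inj_on_def T_def using psubset.prems(4) by (metis (lifting) mem_Collect_eq)
    have xX: "x \<in> X" and yX: "y \<in> X" using xy by (auto simp: T_def)
    have "X - {y} \<subset> X" using yX by blast
    then have "\<exists>S \<subseteq> X - {y}. inj_on f S \<and> inj_on g S \<and>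
       (\<forall>x\<in>X - {y}. (\<exists>y\<in>S. f y = f x \<and> (y = x \<or> P y x)) \<or> (\<exists>y\<in>S. g y = g x \<and> (y = x \<or> R y x)))"
    proof (rule psubset.IH)
      fix u v w assume *: "u \<in> X - {y}" "v \<in> X - {y}" "w \<in> X - {y}"
      show "P u w" if "f u = f v" "f v = f w" "P u v" "P v w"
        by (rule psubset.prems(2)[of u v w]) (use that * in simp_all)
      show "R u w" if "g u = g v" "g v = g w" "R u v" "R v w"
        by (rule psubset.prems(5)[of u v w]) (use that * in simp_all)
    qed (use psubset.prems(1,3,4) in simp_all)
    then obtain S where S: "S \<subseteq> X - {y}" "inj_on f S" "inj_on g S"
      and st: "\<And>x. x \<in> X - {y} \<Longrightarrow>
        (\<exists>y\<in>S. f y = f x \<and> (y = x \<or> P y x)) \<or> (\<exists>y\<in>S. g y = g x \<and> (y = x \<or> R y x))"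
      by blast
    text \<open>The edge \<open>x\<close> is the best one of its man, so \<open>S\<close> gives its woman \<open>x\<close> or better, and
      hence something better than \<open>y\<close>.\<close>
    have "x \<in> S" if z: "z \<in> S" "f z = f x" "z = x \<or> P z x" for z
    proof (rule ccontr)
      assume "x \<notin> S"
      then have "z \<noteq> x" using z(1) by blast
      then have "P x z" "P z x" using z xy(1) S(1) by (auto simp: T_def)
      then show False
        using psubset.prems(2)[of x z x] psubset.prems(3)[OF xX] xX z(1,2) S(1) by auto
    qed
    then have "\<exists>z\<in>S. g z = g x \<and> (z = x \<or> R z x)"
      using st[of x] xX xy(4) by blast
    then obtain z where "z \<in> S" "g z = g x" "z = x \<or> R z x" by blast
    then have "g z = g y" "R z y" 
      using xy S(1) xX yX psubset.prems(5)[of z x y] by auto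
    then show ?thesis using S st \<open>z \<in> S\<close> by (intro exI[of _ S]) blast
  qed
qed

section \<open>Potentials\<close>

fun path_weight :: "('a \<Rightarrow> 'a \<Rightarrow> int) \<Rightarrow> 'a list \<Rightarrow> int" where
  "path_weight c (x # y # xs) = c x y + path_weight c (y # xs)"
| "path_weight c xs = 0"

lemma path_weight_append:
  "path_weight c (xs @ x # ys) = path_weight c (xs @ [x]) + path_weight c (x # ys)"
proof (induction xs)
  case (Cons z xs)
  then show ?case by (cases xs) auto
qed simp

lemma sum_list_closed_path:
  "sum_list (map2 c (x # xs) (xs @ [y])) = path_weight c (x # xs @ [y])"
  by (induction xs arbitrary: x) auto

lemma successively_closed_path:
  assumes "successively R (x # xs @ [y])"
  shows "list_all2 R (x # xs) (xs @ [y])"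
  using assms by (induction xs arbitrary: x) auto

text \<open>\<open>D v\<close> is the largest weight of a simple path that starts at \<open>v\<close>. An optimal path
  from \<open>w\<close> that meets \<open>v\<close> closes, together with the arc from \<open>v\<close> to \<open>w\<close>, a simple cycle,
  and simple cycles are permutations.\<close>

lemma potential_exists:
  fixes c :: "'a \<Rightarrow> 'a \<Rightarrow> int"
  assumes fin: "finite V"
    and refl: "\<And>v. v \<in> V \<Longrightarrow> R v v" "\<And>v. v \<in> V \<Longrightarrow> c v v = 0"
    and perm: "\<And>\<pi>. \<pi> permutes V \<Longrightarrow> (\<And>v. v \<in> V \<Longrightarrow> R v (\<pi> v)) \<Longrightarrow> (\<Sum>v\<in>V. c v (\<pi> v)) \<le> 0"
  shows "\<exists>D. \<forall>v\<in>V. \<forall>w\<in>V. R v w \<longrightarrow> c v w + D w \<le> D v"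
proof -
  define paths where
    "paths v = {xs. distinct (v # xs) \<and> set (v # xs) \<subseteq> V \<and> successively R (v # xs)}" for v
  define D where "D v = Max ((\<lambda>xs. path_weight c (v # xs)) ` paths v)" for v
  have fin_paths: "finite (paths v)" for v
    by (rule finite_subset[OF _ finite_subset_distinct[OF fin]]) (auto simp: paths_def)
  have D_ge: "path_weight c (v # xs) \<le> D v" if "xs \<in> paths v" for v xs
    unfolding D_def using that fin_paths by simp
  have D_eq: "\<exists>xs\<in>paths v. D v = path_weight c (v # xs)" if "v \<in> V" for v
  proof -
    have "[] \<in> paths v" using that by (simp add: paths_def)
    then have "D v \<in> (\<lambda>xs. path_weight c (v # xs)) ` paths v"
      unfolding D_def using fin_paths by (intro Max_in) auto
    then show ?thesis by blast
  qed
  have cycle_le: "path_weight c (v # q @ [v]) \<le> 0"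
    if q: "distinct (v # q)" "set (v # q) \<subseteq> V" "successively R (v # q @ [v])" for v q
  proof -
    define \<pi> where "\<pi> = cycle_of_list (v # q)"
    have rot: "map \<pi> (v # q) = q @ [v]"
      using cyclic_rotation[OF q(1), of 1] by (simp add: \<pi>_def)
    have out: "\<pi> x = x" if "x \<notin> set (v # q)" for x
      unfolding \<pi>_def using that by (rule id_outside_supp)
    have "list_all2 R (v # q) (map \<pi> (v # q))"
      unfolding rot using successively_closed_path[OF q(3)] .
    then have "R x (\<pi> x)" if "x \<in> set (v # q)" for x
      using that unfolding list.rel_map by (metis list.rel_refl_strong list_all2_same)
    \<comment> \<open>Off the cycle, \<open>\<pi>\<close> uses the loops, which are allowed and
      weigh 0, so its total weight is that of the cycle.\<close>
    then have "(\<Sum>x\<in>V. c x (\<pi> x)) \<le> 0"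
      using out refl(1) q(2) permutes_subset[OF cycle_permutes[of "v # q"] q(2)]
      by (intro perm) (metis \<pi>_def)+
    moreover have "(\<Sum>x\<in>V. c x (\<pi> x)) = (\<Sum>x\<in>set (v # q). c x (\<pi> x))"
      using fin q(2) out refl(2) by (intro sum.mono_neutral_right) auto
    moreover have "\<dots> = sum_list (map (\<lambda>x. c x (\<pi> x)) (v # q))"
      using q(1) by (simp only: sum_list_distinct_conv_sum_set)
    moreover have "\<dots> = sum_list (map2 c (v # q) (map \<pi> (v # q)))"
      by (simp add: zip_map2 zip_same_conv_map comp_def)
    moreover have "\<dots> = path_weight c (v # q @ [v])"
      unfolding rot by (rule sum_list_closed_path)
    ultimately show ?thesis by linarith
  qed
  have "c v w + D w \<le> D v" if v: "v \<in> V" and w: "w \<in> V" and vw: "R v w" for v w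
  proof -
    obtain xs where xs: "xs \<in> paths w" "D w = path_weight c (w # xs)" using D_eq[OF w] by blast
    show ?thesis
    proof (cases "v \<in> set (w # xs)")
      case False
      then have "w # xs \<in> paths v" using xs v vw by (auto simp: paths_def)
      then show ?thesis using D_ge[of "w # xs" v] xs(2) by simp
    next
      case True
      then obtain q r where qr: "w # xs = q @ v # r" by (meson split_list)
      have p: "distinct (q @ v # r)" "set (q @ v # r) \<subseteq> V" "successively R (q @ v # r)"
        using xs(1) unfolding paths_def qr[symmetric] by auto
      have "r \<in> paths v" using p by (auto simp: paths_def successively_append_iff)
      moreover have "c v w + path_weight c (q @ [v]) \<le> 0"
      proof (cases q)
        case Nil
        then show ?thesis using qr refl(2)[OF v] by simp
      next
        case (Cons u q')
        then have "u = w" using qr by simp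
        moreover have "successively R (q @ [v])"
          using p(3) successively_append_iff[of R "q @ [v]" r] by simp
        then have "successively R (v # q @ [v])"
          using vw Cons \<open>u = w\<close> by simp
        ultimately show ?thesis using cycle_le[of v q] p Cons by auto
      qed
      ultimately show ?thesis
        using D_ge[of r v] xs(2) path_weight_append[of c q v r] by (simp add: qr)
    qed
  qed
  then show ?thesis by blast
qed

section \<open>Dual witnesses\<close>

text \<open>Fixing unmatched vertices makes \<open>mate M\<close> an involution on \<open>V\<close>,
  so that sums over \<open>V\<close> can be reindexed by it.\<close>

definition mate :: "'v set set \<Rightarrow> 'v \<Rightarrow> 'v" where
  "mate M v = (if matched M v then partner M v else v)"

definition vote :: "'v marriage \<Rightarrow> 'v set set \<Rightarrow> 'v \<Rightarrow> 'v \<Rightarrow> int" where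
  "vote G M v u =
     (if \<not> matched M v then 1
      else if u = partner M v then 0
      else if (u, partner M v) \<in> pref G v then 1 else - 1)"

text \<open>On edges of \<open>N\<close> this agrees with \<open>vote\<close>
  (\<open>swing_matched\<close>); summed over \<open>V\<close> it is the margin of \<open>N\<close>
  over \<open>M\<close> (\<open>phi_diff\<close>).\<close>

definition swing :: "'v marriage \<Rightarrow> 'v set set \<Rightarrow> 'v set set \<Rightarrow> 'v \<Rightarrow> int" where
  "swing G N M v = of_bool (prefers G v N M) - of_bool (prefers G v M N)"

text \<open>\<open>\<alpha>\<close> is an optimal solution of the linear program dual to the maximum-weight feasible
  matching problem, where an edge weighs the sum of the votes of its ends and an unmatched vertex
  counts \<open>-1\<close> if \<open>M\<close> matches it; the second and third clauses are complementary slackness for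
  \<open>M\<close> itself.\<close>

definition witness :: "'v marriage \<Rightarrow> 'v set \<Rightarrow> 'v set set \<Rightarrow> ('v \<Rightarrow> int) \<Rightarrow> bool" where
  "witness G C M \<alpha> \<longleftrightarrow>
     (\<forall>a b. {a, b} \<in> edges G \<longrightarrow> vote G M a b + vote G M b a \<le> \<alpha> a + \<alpha> b) \<and>
     (\<forall>a b. {a, b} \<in> M \<longrightarrow> \<alpha> a + \<alpha> b = 0) \<and>
     (\<forall>v \<in> men G \<union> women G. \<not> matched M v \<longrightarrow> \<alpha> v = 0) \<and>
     (\<forall>v \<in> men G \<union> women G - C. - 1 \<le> \<alpha> v)"

lemma vote_cases: "vote G M v u \<in> {- 1, 0, 1}"
  by (simp add: vote_def)

lemma vote_bounds: "- 1 \<le> vote G M v u" "vote G M v u \<le> 1"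
  by (auto simp: vote_def)

locale critical_marriage =
  fixes G :: "'v marriage" and C :: "'v set"
  assumes instance_G: "marriage_instance G" and critical_men: "C \<subseteq> men G"
begin

abbreviation "V \<equiv> men G \<union> women G"

section \<open>Edges, preferences, matchings and votes\<close>

lemma finite_V: "finite V" "finite (men G)" "finite (women G)"
  using instance_G by (auto simp: marriage_instance_def)

lemma disjoint: "a \<in> men G \<Longrightarrow> b \<in> women G \<Longrightarrow> a \<noteq> b"
  using instance_G by (auto simp: marriage_instance_def)

lemma edgeE:
  assumes "e \<in> edges G"
  obtains a b where "e = {a, b}" "a \<in> men G" "b \<in> women G"
  using instance_G assms by (auto simp: marriage_instance_def)

lemma edge_ends:
  assumes "{u, v} \<in> edges G"
  shows "u \<in> men G \<and> v \<in> women G \<or> u \<in> women G \<and> v \<in> men G"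
  using edgeE[OF assms] by (metis doubleton_eq_iff)

lemma edge_in_V: "{u, v} \<in> edges G \<Longrightarrow> u \<in> V" "{u, v} \<in> edges G \<Longrightarrow> v \<in> V"
  using edge_ends by blast+

lemma pref_order:
  assumes "v \<in> V"
  shows "trans (pref G v)" "irrefl (pref G v)" "total_on (neighbours G v) (pref G v)"
  using instance_G assms by (auto simp: marriage_instance_def strict_linear_order_on_def)

lemma pref_trans:
  assumes "v \<in> V" "(x, y) \<in> pref G v" "(y, z) \<in> pref G v"
  shows "(x, z) \<in> pref G v"
  using pref_order(1)[OF assms(1)] assms(2,3) by (meson transD)

lemma pref_irrefl: "v \<in> V \<Longrightarrow> (x, x) \<notin> pref G v"
  using pref_order(2) by (metis irreflD)

lemma pref_asym: "v \<in> V \<Longrightarrow> (x, y) \<in> pref G v \<Longrightarrow> (y, x) \<notin> pref G v"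
  using pref_trans pref_irrefl by metis

lemma pref_total:
  assumes "{v, x} \<in> edges G" "{v, y} \<in> edges G"
  shows "x = y \<or> (x, y) \<in> pref G v \<or> (y, x) \<in> pref G v"
  using pref_order(3)[OF edge_in_V(1)[OF assms(1)]] assms
  by (auto simp: neighbours_def total_on_def)

lemma matching_edge: "is_matching G M \<Longrightarrow> e \<in> M \<Longrightarrow> e \<in> edges G"
  by (auto simp: is_matching_def)

lemma matching_unique:
  assumes "is_matching G M" "{v, x} \<in> M" "{v, y} \<in> M"
  shows "x = y"
proof -
  have "{v, x} = {v, y}"
    using assms unfolding is_matching_def pairwise_def disjnt_def by (metis disjoint_iff insertI1)
  then show ?thesis by (metis doubleton_eq_iff)
qed

lemma partner_eq:
  assumes "is_matching G M" "{v, u} \<in> M"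
  shows "partner M v = u"
  unfolding partner_def using assms matching_unique by blast

lemma matchedI: "{v, u} \<in> M \<Longrightarrow> matched M v"
  by (auto simp: matched_def)

lemma matchedE:
  assumes "is_matching G M" "matched M v"
  obtains u where "{v, u} \<in> M" "partner M v = u"
proof -
  obtain e where e: "e \<in> M" "v \<in> e" using assms(2) by (auto simp: matched_def)
  obtain a b where "e = {a, b}" using edgeE[OF matching_edge[OF assms(1) e(1)]] by blast
  then have "\<exists>u. {v, u} \<in> M" using e by (metis empty_iff insertE insert_commute)
  then show ?thesis using that partner_eq[OF assms(1)] by blast
qed

lemma vote_unmatched: "\<not> matched M v \<Longrightarrow> vote G M v u = 1"
  by (simp add: vote_def)

lemma vote_matched:
  assumes "is_matching G M" "{v, w} \<in> M"
  shows "vote G M v u = (if u = w then 0 else if (u, w) \<in> pref G v then 1 else - 1)"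
  using assms by (simp add: vote_def partner_eq matchedI)


lemma vote_less_imp_pref:
  assumes M: "is_matching G M" and e: "{v, x} \<in> edges G" "{v, y} \<in> edges G"
    and less: "vote G M v y < vote G M v x"
  shows "(x, y) \<in> pref G v"
proof -
  have "matched M v" using less by (auto simp: vote_def split: if_splits)
  then obtain w where w: "{v, w} \<in> M" using matchedE[OF M] by blast
  have v: "v \<in> V" using edge_in_V e by blast
  have "{v, w} \<in> edges G" using matching_edge[OF M w] .
  then have "x = w \<or> (x, w) \<in> pref G v \<or> (w, x) \<in> pref G v"
    "y = w \<or> (y, w) \<in> pref G v \<or> (w, y) \<in> pref G v"
    using pref_total e by blast+
  then show ?thesis
    using less pref_trans[OF v, of x w y] pref_asym[OF v, of y w] pref_irrefl[OF v, of w]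
    by (auto simp: vote_matched[OF M w] split: if_splits)
qed

lemma mate_matched: "is_matching G M \<Longrightarrow> {v, u} \<in> M \<Longrightarrow> mate M v = u"
  by (simp add: mate_def matchedI partner_eq)

lemma mate_unmatched: "\<not> matched M v \<Longrightarrow> mate M v = v"
  by (simp add: mate_def)

lemma mate_involution:
  assumes "is_matching G M"
  shows "mate M (mate M v) = v"
proof (cases "matched M v")
  case True
  then obtain u where "{v, u} \<in> M" using matchedE[OF assms] by blast
  then show ?thesis by (metis assms insert_commute mate_matched)
qed (simp add: mate_unmatched)

lemma mate_in_V:
  assumes "is_matching G M" "v \<in> V"
  shows "mate M v \<in> V"
proof (cases "matched M v")
  case True
  then obtain u where "{v, u} \<in> M" using matchedE[OF assms(1)] by blast
  then show ?thesis using assms mate_matched matching_edge edge_in_V(2) by metis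
qed (use assms in \<open>simp add: mate_unmatched\<close>)

lemma bij_mate:
  assumes "is_matching G M"
  shows "bij_betw (mate M) V V"
  by (rule bij_betw_byWitness[where f' = "mate M"])
    (use assms mate_involution mate_in_V in auto)

lemma sum_mate:
  assumes "is_matching G M"
  shows "(\<Sum>v\<in>V. h (mate M v)) = (\<Sum>v\<in>V. h v)"
  using sum.reindex_bij_betw[OF bij_mate[OF assms]] .

lemma phi_diff: "int (phi G N M) - int (phi G M N) = (\<Sum>v\<in>V. swing G N M v)"
proof -
  have "int (phi G N M) = (\<Sum>v\<in>V. of_bool (prefers G v N M))" for N M
    using finite_V(1) by (simp add: phi_def Int_def)
  then show ?thesis by (simp add: swing_def sum_subtractf)
qed

lemma swing_matched:
  assumes "is_matching G M" "is_matching G N" "{v, u} \<in> N"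
  shows "swing G N M v = vote G M v u"
proof (cases "matched M v")
  case True
  then obtain w where w: "{v, w} \<in> M" using matchedE[OF assms(1)] by blast
  have v: "v \<in> V" using edge_in_V(1) matching_edge[OF assms(2,3)] .
  have "u = w \<or> (u, w) \<in> pref G v \<or> (w, u) \<in> pref G v"
    using pref_total matching_edge assms w by metis
  then show ?thesis
    using pref_irrefl[OF v] pref_asym[OF v] True w assms
    by (auto simp: swing_def prefers_def vote_matched matchedI partner_eq)
next
  case False
  then show ?thesis
    using assms(3) by (simp add: swing_def prefers_def vote_def matchedI)
qed

lemma swing_unmatched: "\<not> matched N v \<Longrightarrow> swing G N M v = - of_bool (matched M v)"
  by (simp add: swing_def prefers_def)

text \<open>An edge of \<open>M\<close> contains exactly one man, who is matched in
  \<open>N\<close>; sending it to an edge of \<open>N\<close> at this man is injective.\<close>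

lemma card_matching_le:
  assumes M: "is_matching G M" and N: "is_matching G N"
    and sub: "\<And>v. v \<in> men G \<Longrightarrow> matched M v \<Longrightarrow> matched N v"
  shows "card M \<le> card N"
proof -
  have "e \<subseteq> V" if "e \<in> N" for e
    by (rule edgeE[OF matching_edge[OF N that]]) simp
  then have fin: "finite N" using finite_V(1) by (meson Pow_iff finite_Pow_iff finite_subset subsetI)
  have man: "\<exists>a. a \<in> men G \<and> a \<in> e" if "e \<in> M" for e
    using edgeE[OF matching_edge[OF M that]] by blast
  have "\<forall>e\<in>M. \<exists>e'. e' \<in> N \<and> (\<exists>a\<in>men G. a \<in> e \<and> a \<in> e')"
    using man sub unfolding matched_def by (meson UnionE UnionI)
  then obtain f where f: "\<And>e. e \<in> M \<Longrightarrow> f e \<in> N \<and> (\<exists>a\<in>men G. a \<in> e \<and> a \<in> f e)" by metis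
  have "inj_on f M"
  proof (rule inj_onI)
    fix d e assume de: "d \<in> M" "e \<in> M" "f d = f e"
    obtain x where x: "x \<in> men G" "x \<in> d" "x \<in> f d" using f de by blast
    obtain y where y: "y \<in> men G" "y \<in> e" "y \<in> f d" using f de by metis
    have "f d \<in> edges G" using matching_edge[OF N] f de(1) by blast
    then have "x = y" using x y disjoint by (elim edgeE) auto
    then show "d = e" using x y de M unfolding is_matching_def pairwise_def disjnt_def by blast
  qed
  then show ?thesis using card_inj_on_le f fin by blast
qed

section \<open>Weak duality and complementary slackness\<close>

lemma witness_edge:
  "witness G C M \<alpha> \<Longrightarrow> {a, b} \<in> edges G \<Longrightarrow> vote G M a b + vote G M b a \<le> \<alpha> a + \<alpha> b"
  by (simp add: witness_def)

lemma witness_mate: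
  assumes "is_matching G M" "witness G C M \<alpha>" "v \<in> V"
  shows "\<alpha> v + \<alpha> (mate M v) = 0"
proof (cases "matched M v")
  case True
  then obtain u where "{v, u} \<in> M" using matchedE[OF assms(1)] by blast
  then show ?thesis using assms by (simp add: witness_def mate_matched)
qed (use assms in \<open>simp add: witness_def mate_unmatched\<close>)

text \<open>Local form of weak duality. A vertex left out by \<open>N\<close> is its own mate, which
  doubles both sides, and feasibility of \<open>N\<close> puts it outside \<open>C\<close>, where
  \<open>\<alpha>\<close> is at least -1.\<close>

lemma swing_mate_le:
  assumes M: "feasible_matching G C M" "witness G C M \<alpha>" and N: "feasible_matching G C N"
    and v: "v \<in> V"
  shows "swing G N M v + swing G N M (mate N v) \<le> \<alpha> v + \<alpha> (mate N v)"
proof (cases "matched N v")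
  case True
  have MN: "is_matching G M" "is_matching G N" using M N by (auto simp: feasible_matching_def)
  then obtain u where u: "{v, u} \<in> N" "{u, v} \<in> N" using matchedE True by (metis insert_commute)
  then show ?thesis
    using witness_edge[OF M(2) matching_edge[OF MN(2) u(1)]] MN
    by (simp add: mate_matched swing_matched)
next
  case False
  then have "v \<notin> C" using N by (auto simp: feasible_matching_def)
  then show ?thesis
    using False M v by (auto simp: mate_unmatched swing_unmatched witness_def)
qed

lemma sum_mate_double:
  assumes "is_matching G N"
  shows "(\<Sum>v\<in>V. h v + h (mate N v)) = 2 * (\<Sum>v\<in>V. h v :: int)"
  by (simp only: sum.distrib sum_mate[OF assms])

lemma witness_sum:
  assumes "is_matching G M" "witness G C M \<alpha>"
  shows "(\<Sum>v\<in>V. \<alpha> v) = 0"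
  using sum_mate_double[OF assms(1), of \<alpha>] witness_mate[OF assms] by simp

lemma popular_if_witness:
  assumes M: "feasible_matching G C M" "witness G C M \<alpha>"
  shows "popular_feasible G C M"
proof -
  have "phi G N M \<le> phi G M N" if N: "feasible_matching G C N" for N
  proof -
    have MN: "is_matching G M" "is_matching G N" using M N by (auto simp: feasible_matching_def)
    have "(\<Sum>v\<in>V. swing G N M v + swing G N M (mate N v)) \<le> (\<Sum>v\<in>V. \<alpha> v + \<alpha> (mate N v))"
      by (intro sum_mono swing_mate_le[OF M N])
    then have "(\<Sum>v\<in>V. swing G N M v) \<le> 0"
      using witness_sum[OF MN(1) M(2)] unfolding sum_mate_double[OF MN(2)] by simp
    then show ?thesis using phi_diff[of N M] by linarith
  qed
  then show ?thesis using M by (auto simp: popular_feasible_def)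
qed

text \<open>Complementary slackness for \<open>N\<close>: the slacks in \<open>swing_mate_le\<close>
  are nonnegative and sum to 0.\<close>

lemma tight_if_phi_eq:
  assumes M: "feasible_matching G C M" "witness G C M \<alpha>" and N: "feasible_matching G C N"
    and eq: "phi G N M = phi G M N" and v: "v \<in> V"
  shows "swing G N M v + swing G N M (mate N v) = \<alpha> v + \<alpha> (mate N v)"
proof -
  have MN: "is_matching G M" "is_matching G N" using M N by (auto simp: feasible_matching_def)
  define h where "h v = \<alpha> v - swing G N M v" for v
  have "(\<Sum>v\<in>V. h v + h (mate N v)) = 0"
    unfolding sum_mate_double[OF MN(2)] using witness_sum[OF MN(1) M(2)] phi_diff[of N M] eq
    by (simp add: h_def sum_subtractf)
  moreover have "0 \<le> h v + h (mate N v)" if "v \<in> V" for v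
    using swing_mate_le[OF M N that] by (simp add: h_def)
  ultimately have "h v + h (mate N v) = 0"
    using v finite_V(1) by (simp add: sum_nonneg_eq_0_iff del: Un_iff)
  then show ?thesis by (simp add: h_def)
qed

lemma min_size_if_even_witness:
  assumes M: "feasible_matching G C M" "witness G C M \<alpha>"
    and even: "\<And>v. v \<in> V \<Longrightarrow> even (\<alpha> v)"
  shows "min_size_popular_feasible G C M"
proof -
  have pop: "popular_feasible G C M" by (rule popular_if_witness[OF M])
  have "card M \<le> card N" if N: "popular_feasible G C N" for N
  proof -
    have N': "feasible_matching G C N" using N by (auto simp: popular_feasible_def)
    have "phi G N M = phi G M N" using pop N by (auto simp: popular_feasible_def intro: antisym)
    note tight = tight_if_phi_eq[OF M N' this]
    have "matched N v" if v: "v \<in> V" "matched M v" for v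
    proof (rule ccontr)
      assume "\<not> matched N v"
      \<comment> \<open>As its own mate in \<open>N\<close>, \<open>v\<close> has a tight inequality
        that reads -2 = 2 \<alpha> v.\<close>
      then have "\<alpha> v = - 1" using tight[OF v(1)] v(2) by (simp add: mate_unmatched swing_unmatched)
      then show False using even[OF v(1)] by simp
    qed
    then show ?thesis using card_matching_le M(1) N' by (auto simp: feasible_matching_def)
  qed
  then show ?thesis using pop by (simp add: min_size_popular_feasible_def)
qed

text \<open>A vote is 0 exactly when the other vertex is the partner in \<open>M\<close>, which
  holds from both sides or from neither; all other votes are odd.\<close>

lemma vote_sum_even:
  assumes M: "is_matching G M"
  shows "even (vote G M u v + vote G M v u)"
proof -
  have "v = partner M u \<and> matched M u \<longleftrightarrow> u = partner M v \<and> matched M v"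
    using matchedE[OF M] M by (metis insert_commute matchedI partner_eq)
  then show ?thesis by (auto simp: vote_def)
qed

lemma dominant_if_odd_witness:
  assumes M: "feasible_matching G C M" "witness G C M \<alpha>"
    and odd: "\<And>v. v \<in> V \<Longrightarrow> matched M v \<Longrightarrow> odd (\<alpha> v)"
  shows "dominant_feasible G C M"
proof -
  have pop: "popular_feasible G C M" by (rule popular_if_witness[OF M])
  have "phi G N M < phi G M N" if N: "feasible_matching G C N" and less: "card M < card N" for N
  proof (rule ccontr)
    assume "\<not> phi G N M < phi G M N"
    then have "phi G N M = phi G M N"
      using pop N by (simp add: popular_feasible_def order_antisym)
    note tight = tight_if_phi_eq[OF M N this]
    have MN: "is_matching G M" "is_matching G N" using M N by (auto simp: feasible_matching_def)
    \<comment> \<open>If \<open>M\<close> misses \<open>v\<close>, then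
      \<open>\<alpha> v = 0\<close> and tightness makes \<open>\<alpha> u\<close> an even sum of
      votes. This is impossible if \<open>M\<close> matches \<open>u\<close>; otherwise two votes of
      1 meet two values 0.\<close>
    have "matched M v" if v: "v \<in> V" "matched N v" for v
    proof (rule ccontr)
      assume un: "\<not> matched M v"
      obtain u where u: "{v, u} \<in> N" using matchedE[OF MN(2) v(2)] by blast
      have e: "{v, u} \<in> edges G" "u \<in> V"
        using matching_edge[OF MN(2) u] edge_in_V by auto
      have "vote G M v u + vote G M u v = \<alpha> v + \<alpha> u"
        using tight[OF v(1)] u MN by (simp add: mate_matched swing_matched insert_commute)
      moreover have "\<alpha> v = 0" using M(2) v un by (simp add: witness_def)
      ultimately show False
        using vote_sum_even[OF MN(1), of v u] odd[OF e(2)] M(2) e(2) un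
        by (cases "matched M u") (auto simp: vote_unmatched witness_def)
    qed
    then have "card N \<le> card M" using card_matching_le MN by blast
    then show False using less by simp
  qed
  then show ?thesis using pop by (simp add: dominant_feasible_def)
qed

section \<open>Strong duality: dual values from popularity\<close>

text \<open>Every vertex gets a private dummy partner on the other side, and all dummies are pairwise
  adjacent by edges of weight \<open>0\<close>. Feasible matchings become perfect
  ones; since a dummy can be named by its vertex, both sides are indexed by \<open>V\<close>, and the perfect
  matchings are the bijections that respect \<open>admissible\<close>.\<close>

definition admissible :: "'v \<Rightarrow> 'v \<Rightarrow> bool" where
  "admissible v u \<longleftrightarrow>
     v \<in> men G \<and> {v, u} \<in> edges G \<or> v = u \<and> v \<notin> C \<or> v \<in> women G \<and> u \<in> men G"

text \<open>The first argument ranges over men and dummies of women, the second over women and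
  dummies of men. So \<open>v = u\<close> pairs a vertex with its own dummy, leaving it unmatched,
  and a woman followed by a man stands for two dummies.\<close>

definition weight :: "'v set set \<Rightarrow> 'v \<Rightarrow> 'v \<Rightarrow> int" where
  "weight M v u =
     (if v \<in> men G \<and> u \<in> women G then vote G M v u + vote G M u v
      else if v = u then - of_bool (matched M v) else 0)"

text \<open>The men sent to women by \<open>\<sigma>\<close> form a feasible matching
  \<open>N\<close>, since critical men have no edge to their dummy. The weight of
  \<open>\<sigma>\<close> is the margin of \<open>N\<close> over \<open>M\<close>.\<close>

lemma admissible_sum_le:
  assumes pop: "popular_feasible G C M" and bij: "bij_betw \<sigma> V V"
    and adm: "\<And>v. v \<in> V \<Longrightarrow> admissible v (\<sigma> v)"
  shows "(\<Sum>v\<in>V. weight M v (\<sigma> v)) \<le> 0"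
proof -
  define N where "N = {{a, \<sigma> a} |a. a \<in> men G \<and> \<sigma> a \<in> women G}"
  have M: "is_matching G M" using pop by (simp add: popular_feasible_def feasible_matching_def)
  have inj: "x = y" if "x \<in> V" "y \<in> V" "\<sigma> x = \<sigma> y" for x y
    using bij_betw_imp_inj_on[OF bij] that by (meson inj_onD)
  have edge: "{a, \<sigma> a} \<in> edges G" if "a \<in> men G" "\<sigma> a \<in> women G" for a
    using adm[of a] that disjoint by (auto simp: admissible_def)
  have NI: "{a, \<sigma> a} \<in> N" if "a \<in> men G" "\<sigma> a \<in> women G" for a
    using that unfolding N_def by blast
  have man: "\<sigma> a = a \<or> \<sigma> a \<in> women G" if "a \<in> men G" for a
    using adm[of a] that disjoint edge_ends[of a "\<sigma> a"] by (auto simp: admissible_def)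
  have woman: "\<sigma> b = b \<or> \<sigma> b \<in> men G" if "b \<in> women G" for b
    using adm[of b] that disjoint by (auto simp: admissible_def)
  have N: "is_matching G N"
    unfolding is_matching_def
  proof
    show "N \<subseteq> edges G" using edge by (auto simp: N_def)
    have "disjnt {a, \<sigma> a} {a', \<sigma> a'}"
      if "a \<in> men G" "\<sigma> a \<in> women G" "a' \<in> men G" "\<sigma> a' \<in> women G" "a \<noteq> a'" for a a'
      using inj[of a a'] disjoint[of a "\<sigma> a'"] disjoint[of a' "\<sigma> a"] that by (auto simp: disjnt_def)
    then show "pairwise disjnt N"
      unfolding pairwise_def N_def by blast
  qed
  have feas: "feasible_matching G C N"
    unfolding feasible_matching_def
  proof (intro conjI ballI N)
    fix v assume v: "v \<in> C"
    then have "v \<in> men G" using critical_men by blast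
    then have "\<sigma> v \<in> women G"
      using adm[of v] v edge_ends[of v "\<sigma> v"] disjoint by (auto simp: admissible_def)
    with \<open>v \<in> men G\<close> show "matched N v" by (intro matchedI[OF NI])
  qed
  have fixed: "\<not> matched N v" if v: "v \<in> V" "\<sigma> v = v" for v
  proof
    assume "matched N v"
    then obtain a where a: "a \<in> men G" "\<sigma> a \<in> women G" "v \<in> {a, \<sigma> a}"
      by (auto simp: N_def matched_def)
    then have "a = v" using inj[of a v] v by auto
    then show False using a v disjoint by auto
  qed
  \<comment> \<open>Each weight splits into the shares of the real vertices: men on the first side,
    women on the second. Reindexing the second shares by \<open>\<sigma>\<close> yields the sum of
    all swings.\<close>
  have split: "weight M v (\<sigma> v) =
      (if v \<in> men G then swing G N M v else 0) + (if \<sigma> v \<in> women G then swing G N M (\<sigma> v) else 0)"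
    if v: "v \<in> V" for v
  proof (cases "v \<in> men G \<and> \<sigma> v \<in> women G")
    case True
    then have "swing G N M v = vote G M v (\<sigma> v)" "swing G N M (\<sigma> v) = vote G M (\<sigma> v) v"
      using NI[of v] swing_matched[OF M N] by (auto simp: insert_commute)
    then show ?thesis using True by (simp add: weight_def)
  next
    case False
    show ?thesis
    proof (cases "\<sigma> v = v")
      case True
      then show ?thesis
        using False v fixed[OF v] disjoint by (auto simp: weight_def swing_unmatched)
    next
      case n: False
      then have "v \<in> women G" "\<sigma> v \<in> men G" using v False man woman by auto
      then show ?thesis using n disjoint by (auto simp: weight_def)
    qed
  qed
  have "(\<Sum>v\<in>V. weight M v (\<sigma> v)) =
      (\<Sum>v\<in>V. if v \<in> men G then swing G N M v else 0) +
      (\<Sum>v\<in>V. (\<lambda>u. if u \<in> women G then swing G N M u else 0) (\<sigma> v))"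
    unfolding sum.distrib[symmetric] by (intro sum.cong refl) (rule split)
  also have "\<dots> = (\<Sum>v\<in>V. if v \<in> men G then swing G N M v else 0) +
      (\<Sum>u\<in>V. if u \<in> women G then swing G N M u else 0)"
    by (subst sum.reindex_bij_betw[OF bij]) simp
  also have "\<dots> = (\<Sum>v\<in>V. swing G N M v)"
    unfolding sum.distrib[symmetric] using disjoint by (intro sum.cong) auto
  also have "\<dots> \<le> 0"
    using pop feas phi_diff[of N M] by (auto simp: popular_feasible_def)
  finally show ?thesis .
qed

text \<open>The dummies of the two ends of a matching edge are matched to each other. This forces the
  potential of the dummies to be constant, up to the sign coming from their side, and shifting by
  that constant \<open>k\<close> makes it vanish.\<close>

lemma witness_exists:
  assumes pop: "popular_feasible G C M" and "M \<noteq> {}"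
  obtains \<alpha> where "witness G C M \<alpha>"
proof -
  have M: "is_matching G M" and feas: "feasible_matching G C M"
    using pop by (auto simp: popular_feasible_def feasible_matching_def)
  have adm_mate: "admissible v (mate M v)" "weight M v (mate M v) = 0" if v: "v \<in> V" for v
  proof -
    have "admissible v (mate M v) \<and> weight M v (mate M v) = 0"
    proof (cases "matched M v")
      case True
      then obtain u where u: "{v, u} \<in> M" using matchedE[OF M] by blast
      have u': "{u, v} \<in> M" using u by (simp add: insert_commute)
      have "mate M v = u" "{v, u} \<in> edges G" "vote G M v u = 0" "vote G M u v = 0"
        using u u' mate_matched M matching_edge vote_matched[OF M] by auto
      then show ?thesis
        using edge_ends[of v u] disjoint by (auto simp: admissible_def weight_def)
    next
      case False
      then show ?thesis
        using feas disjoint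
        by (auto simp: mate_unmatched admissible_def weight_def feasible_matching_def)
    qed
    then show "admissible v (mate M v)" "weight M v (mate M v) = 0" by auto
  qed
  \<comment> \<open>An arc from \<open>v\<close> to \<open>w\<close> gives \<open>v\<close> the mate
    of \<open>w\<close>, so a permutation \<open>\<pi>\<close> along arcs encodes the admissible
    bijection \<open>mate M \<circ> \<pi>\<close>.\<close>
  have "\<exists>D. \<forall>v\<in>V. \<forall>w\<in>V. admissible v (mate M w) \<longrightarrow> weight M v (mate M w) + D w \<le> D v"
  proof (rule potential_exists[OF finite_V(1)])
    fix \<pi> assume \<pi>: "\<pi> permutes V" and adm: "\<And>v. v \<in> V \<Longrightarrow> admissible v (mate M (\<pi> v))"
    have "bij_betw (mate M \<circ> \<pi>) V V"
      using permutes_imp_bij[OF \<pi>] bij_mate[OF M] by (rule bij_betw_trans)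
    then show "(\<Sum>v\<in>V. weight M v (mate M (\<pi> v))) \<le> 0"
      using admissible_sum_le[OF pop, of "mate M \<circ> \<pi>"] adm by simp
  qed (use adm_mate in blast)+
  then obtain D where D: "\<And>v w. v \<in> V \<Longrightarrow> w \<in> V \<Longrightarrow> admissible v (mate M w) \<Longrightarrow>
      weight M v (mate M w) + D w \<le> D v"
    by blast
  define E where "E u = - D (mate M u)" for u
  have DE: "weight M v u \<le> D v + E u" if "v \<in> V" "u \<in> V" "admissible v u" for v u
    using D[of v "mate M u"] that mate_in_V[OF M] mate_involution[OF M] by (simp add: E_def)
  have D0: "D v + E (mate M v) = 0" for v
    using mate_involution[OF M] by (simp add: E_def)
  obtain a0 b0 where ab0: "{a0, b0} \<in> M" "a0 \<in> men G" "b0 \<in> women G"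
    using \<open>M \<noteq> {}\<close> edgeE matching_edge[OF M] by (metis all_not_in_conv)
  define k where "k = D b0"
  have Ea0: "E a0 = - k"
    using D0[of b0] ab0(1) mate_matched[OF M, of b0 a0] by (simp add: k_def insert_commute)
  have dummy: "0 \<le> D b + E a" if "b \<in> women G" "a \<in> men G" for a b
    using DE[of b a] that disjoint[of a b] disjoint[of b]
    by (auto simp: admissible_def weight_def split: if_splits)
  have D_woman: "k \<le> D b" if "b \<in> women G" for b
    using dummy[OF that ab0(2)] Ea0 by simp
  have E_man: "- k \<le> E a" if "a \<in> men G" for a
    using dummy[OF ab0(3) that] by (simp add: k_def)
  \<comment> \<open>Putting 0 in place of the shifted potential at unmatched vertices never
    decreases it, by \<open>man_ge\<close> and \<open>woman_ge\<close>.\<close>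
  define \<alpha> where "\<alpha> v =
     (if \<not> matched M v then 0 else if v \<in> men G then D v - k else E v + k)" for v
  have man_ge: "D a - k \<le> \<alpha> a" if "a \<in> men G" for a
    using D0[of a] E_man[OF that] that by (auto simp: \<alpha>_def mate_unmatched)
  have woman_ge: "E b + k \<le> \<alpha> b" if "b \<in> women G" for b
    using D0[of b] D_woman[OF that] that disjoint by (auto simp: \<alpha>_def mate_unmatched)
  have matched_dual: "D b = k \<and> E a = - k" if "{a, b} \<in> M" "a \<in> men G" "b \<in> women G" for a b
  proof -
    have "mate M b = a" using that mate_matched[OF M] by (simp add: insert_commute)
    then have "D b + E a = 0" using D0[of b] by simp
    then show ?thesis using D_woman E_man that by fastforce
  qed
  have pair: "\<alpha> a + \<alpha> b = 0" if "{a, b} \<in> M" "a \<in> men G" "b \<in> women G" for a b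
  proof -
    have "matched M a" "matched M b" "mate M a = b"
      using that mate_matched[OF M] matchedI[of a b] matchedI[of b a] by (auto simp: insert_commute)
    moreover have "b \<notin> men G" using that disjoint by blast
    ultimately show ?thesis using that D0[of a] by (simp add: \<alpha>_def)
  qed
  have "witness G C M \<alpha>"
    unfolding witness_def
  proof (intro conjI allI ballI impI)
    fix a b assume e: "{a, b} \<in> edges G"
    have *: "vote G M a b + vote G M b a \<le> \<alpha> a + \<alpha> b"
      if "a \<in> men G" "b \<in> women G" "{a, b} \<in> edges G" for a b
      using DE[of a b] man_ge woman_ge that by (fastforce simp: admissible_def weight_def)
    show "vote G M a b + vote G M b a \<le> \<alpha> a + \<alpha> b"
      using *[of a b] *[of b a] e edge_ends[OF e] by (auto simp: insert_commute)
  next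
    fix a b assume e: "{a, b} \<in> M"
    then show "\<alpha> a + \<alpha> b = 0"
      using pair[of a b] pair[of b a] edge_ends[OF matching_edge[OF M e]]
      by (auto simp: insert_commute)
  next
    fix v assume v: "v \<in> V - C"
    have "weight M v v \<le> D v + E v" if "v \<in> V"
      using DE[of v v] v by (auto simp: admissible_def)
    \<comment> \<open>This is the constraint for \<open>v\<close> and its dummy. If \<open>v\<close>
      is matched, \<open>matched_dual\<close> gives the dummy the value \<open>k\<close> or
      \<open>- k\<close>, and the lower bound on \<open>\<alpha> v\<close> results.\<close>
    then have loop: "- of_bool (matched M v) \<le> D v + E v"
      using v disjoint by (auto simp: weight_def split: if_splits)
    show "- 1 \<le> \<alpha> v"
    proof (cases "matched M v")
      case True
      then obtain u where u: "{v, u} \<in> M" using matchedE[OF M] by blast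
      have u': "{u, v} \<in> M" using u by (simp add: insert_commute)
      show ?thesis
        using edge_ends[OF matching_edge[OF M u]]
      proof
        assume "v \<in> men G \<and> u \<in> women G"
        then show ?thesis using matched_dual[OF u] loop True by (simp add: \<alpha>_def)
      next
        assume *: "v \<in> women G \<and> u \<in> men G"
        then have "v \<notin> men G" using disjoint by blast
        then show ?thesis using * matched_dual[OF u'] loop True by (simp add: \<alpha>_def)
      qed
    qed (simp add: \<alpha>_def)
  qed (simp add: \<alpha>_def)
  then show thesis by (rule that)
qed

end

section \<open>Matchings with values of a single parity\<close>

context critical_marriage begin

definition off_parity :: "('v \<Rightarrow> int) \<Rightarrow> int \<Rightarrow> 'v \<Rightarrow> bool" where
  "off_parity \<alpha> s v \<longleftrightarrow> v \<in> V \<and> odd (\<alpha> v - s)"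

text \<open>A triple \<open>(a, b, t)\<close> stands for the edge \<open>{a, b}\<close> with the dual values \<open>- t\<close> at \<open>a\<close> and
  \<open>t\<close> at \<open>b\<close>. The last two clauses say that an end either increases its dual value, or decreases
  it by one without getting a worse partner than in \<open>M\<close>.\<close>

definition candidates :: "'v set set \<Rightarrow> ('v \<Rightarrow> int) \<Rightarrow> int \<Rightarrow> ('v \<times> 'v \<times> int) set" where
  "candidates M \<alpha> s = {(a, b, t).
     a \<in> men G \<and> b \<in> women G \<and> off_parity \<alpha> s a \<and> off_parity \<alpha> s b \<and> {a, b} \<in> edges G \<and>
     - 1 \<le> t \<and> even (t - s) \<and> (t \<le> 1 \<or> a \<in> C) \<and>
     (t \<le> - \<alpha> a - 1 \<or> t = 1 - \<alpha> a \<and> 0 \<le> vote G M a b) \<and>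
     (\<alpha> b + 1 \<le> t \<or> t = \<alpha> b - 1 \<and> 0 \<le> vote G M b a)}"

lemma vote_better:
  assumes M: "is_matching G M" and v: "v \<in> V" and "(w, u) \<in> pref G v" "0 \<le> vote G M v u"
  shows "vote G M v w = 1"
proof (cases "matched M v")
  case True
  then obtain x where x: "{v, x} \<in> M" using matchedE[OF M] by blast
  then have "u = x \<or> (u, x) \<in> pref G v"
    using assms(4) by (auto simp: vote_matched[OF M x] split: if_splits)
  then show ?thesis
    using assms(3) pref_trans[OF v, of w u x] pref_irrefl[OF v]
    by (auto simp: vote_matched[OF M x])
qed (simp add: vote_unmatched)

lemma vote_zero:
  assumes "is_matching G M" "vote G M v u = 0"
  shows "{v, u} \<in> M"
proof -
  have "matched M v" "u = partner M v" using assms(2) by (auto simp: vote_def split: if_splits)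
  then show ?thesis using matchedE[OF assms(1)] by blast
qed

end

text \<open>\<open>S\<close> is a stable matching of the candidates. Each end ranks a triple first
  by its own new dual value, \<open>- t\<close> or \<open>t\<close>, and breaks ties by its
  preferences.\<close>

locale exchange = critical_marriage G C for G :: "'v marriage" and C +
  fixes M :: "'v set set" and \<alpha> :: "'v \<Rightarrow> int" and s :: int and S :: "('v \<times> 'v \<times> int) set"
  assumes M_feasible: "feasible_matching G C M" and M_witness: "witness G C M \<alpha>"
    and s01: "s = 0 \<or> s = 1"
    and S_sub: "S \<subseteq> candidates M \<alpha> s"
    and S_man: "(a, b, t) \<in> S \<Longrightarrow> (a, b', t') \<in> S \<Longrightarrow> b = b' \<and> t = t'"
    and S_woman: "(a, b, t) \<in> S \<Longrightarrow> (a', b, t') \<in> S \<Longrightarrow> a = a' \<and> t = t'"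
    and S_stable: "(a, b, t) \<in> candidates M \<alpha> s \<Longrightarrow>
      (\<exists>b' t'. (a, b', t') \<in> S \<and> (b' = b \<and> t' = t \<or> t' < t \<or> t' = t \<and> (b', b) \<in> pref G a)) \<or>
      (\<exists>a' t'. (a', b, t') \<in> S \<and> (a' = a \<and> t' = t \<or> t < t' \<or> t' = t \<and> (a', a) \<in> pref G b))"
begin

abbreviation "Q \<equiv> off_parity \<alpha> s"

lemma M_matching: "is_matching G M"
  using M_feasible by (simp add: feasible_matching_def)

lemma M_pair: "{a, b} \<in> M \<Longrightarrow> \<alpha> a = - \<alpha> b"
  using M_witness by (fastforce simp: witness_def)

lemma M_unmatched: "v \<in> V \<Longrightarrow> \<not> matched M v \<Longrightarrow> \<alpha> v = 0"
  using M_witness by (simp add: witness_def)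

lemma M_lower: "v \<in> V \<Longrightarrow> v \<notin> C \<Longrightarrow> - 1 \<le> \<alpha> v"
  using M_witness by (simp add: witness_def)

lemma woman_not_critical: "b \<in> women G \<Longrightarrow> b \<notin> C"
  using critical_men disjoint by blast

lemma Q_in_V: "Q v \<Longrightarrow> v \<in> V"
  by (simp add: off_parity_def)

lemma Q_pair: "{a, b} \<in> M \<Longrightarrow> Q a \<Longrightarrow> Q b"
  using M_pair[of a b] edge_in_V(2)[OF matching_edge[OF M_matching]]
  by (auto simp: off_parity_def)

lemma S_D:
  assumes "(a, b, t) \<in> S"
  shows "a \<in> men G" "b \<in> women G" "Q a" "Q b" "{a, b} \<in> edges G" "{b, a} \<in> edges G"
    "- 1 \<le> t" "even (t - s)" "t \<le> 1 \<or> a \<in> C"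
    "t \<le> - \<alpha> a - 1 \<or> t = 1 - \<alpha> a \<and> 0 \<le> vote G M a b"
    "\<alpha> b + 1 \<le> t \<or> t = \<alpha> b - 1 \<and> 0 \<le> vote G M b a"
  using assms S_sub by (auto simp: candidates_def insert_commute)

text \<open>The old edge is offered with the man's value lowered by one, which the last assumption
  permits. If \<open>a\<close> were left out, stability would give his old partner a better triple,
  whose edge would violate the dual inequality for \<open>M\<close>.\<close>

lemma man_kept:
  assumes a: "a \<in> men G" "Q a" "matched M a" "0 \<le> \<alpha> a \<or> a \<in> C"
  shows "\<exists>b t. (a, b, t) \<in> S"
proof -
  obtain b where b: "{a, b} \<in> M" using matchedE[OF M_matching a(3)] by blast
  have b': "{b, a} \<in> M" using b by (simp add: insert_commute)
  note e = matching_edge[OF M_matching b]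
  have bw: "b \<in> women G" using edge_ends[OF e] a(1) disjoint by blast
  have bQ: "Q b" using Q_pair[OF b a(2)] .
  have \<alpha>: "\<alpha> a = - \<alpha> b" using M_pair[OF b] .
  have "- 1 \<le> \<alpha> b" using M_lower bw woman_not_critical by blast
  moreover have "even (\<alpha> b + 1 - s)" using bQ by (auto simp: off_parity_def)
  ultimately have "(a, b, \<alpha> b + 1) \<in> candidates M \<alpha> s"
    using a bw bQ e \<alpha> vote_matched[OF M_matching b, of b] by (auto simp: candidates_def)
  from S_stable[OF this] consider (kept) b' t' where "(a, b', t') \<in> S"
    | (better) a' l where "(a', b, l) \<in> S"
        "a' = a \<and> l = \<alpha> b + 1 \<or> \<alpha> b + 1 < l \<or> l = \<alpha> b + 1 \<and> (a', a) \<in> pref G b"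
    by blast
  then show ?thesis
  proof cases
    case (better a' l)
    note S = better(1)
    show ?thesis
    proof (cases "a' = a")
      case False
      then have "{a', b} \<notin> M" using matching_unique[OF M_matching b', of a'] by (auto simp: insert_commute)
      \<comment> \<open>Off \<open>M\<close> no vote is 0, so a nonnegative vote of the rival is
        1.\<close>
      then have "vote G M a' b = 1 \<or> vote G M a' b = - 1"
        using vote_zero[OF M_matching] vote_cases[of G M a' b] by blast
      moreover have "vote G M b a' = (if (a', a) \<in> pref G b then 1 else - 1)"
        using vote_matched[OF M_matching b'] False by simp
      ultimately show ?thesis
        using S_D(10)[OF S] witness_edge[OF M_witness S_D(5)[OF S]] better(2) False
        by (auto split: if_splits)
    qed (use S in blast)
  qed blast
qed

text \<open>Mirror image of \<open>man_kept\<close>: now the woman's value is lowered by one and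
  stays at least -1 because \<open>0 \<le> \<alpha> b\<close>.\<close>

lemma woman_kept:
  assumes b: "b \<in> women G" "Q b" "matched M b" "0 \<le> \<alpha> b"
  shows "\<exists>a t. (a, b, t) \<in> S"
proof -
  obtain a where b': "{b, a} \<in> M" using matchedE[OF M_matching b(3)] by blast
  have a: "{a, b} \<in> M" using b' by (simp add: insert_commute)
  note e = matching_edge[OF M_matching a]
  have am: "a \<in> men G" using edge_ends[OF e] b(1) disjoint by blast
  have aQ: "Q a" using Q_pair[OF b' b(2)] .
  have \<alpha>: "\<alpha> a = - \<alpha> b" using M_pair[OF a] .
  have "a \<notin> C \<Longrightarrow> - 1 \<le> \<alpha> a" using M_lower am by blast
  moreover have "even (\<alpha> b - 1 - s)" using b(2) by (auto simp: off_parity_def)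
  ultimately have "(a, b, \<alpha> b - 1) \<in> candidates M \<alpha> s"
    using b am aQ e \<alpha> vote_matched[OF M_matching b', of a] by (auto simp: candidates_def)
  from S_stable[OF this] consider (kept) a' t' where "(a', b, t') \<in> S"
    | (better) b1 l where "(a, b1, l) \<in> S"
        "b1 = b \<and> l = \<alpha> b - 1 \<or> l < \<alpha> b - 1 \<or> l = \<alpha> b - 1 \<and> (b1, b) \<in> pref G a"
    by blast
  then show ?thesis
  proof cases
    case (better b1 l)
    note S = better(1)
    show ?thesis
    proof (cases "b1 = b")
      case False
      then have "{b1, a} \<notin> M" using matching_unique[OF M_matching a, of b1] by (auto simp: insert_commute)
      then have "vote G M b1 a = 1 \<or> vote G M b1 a = - 1"
        using vote_zero[OF M_matching] vote_cases[of G M b1 a] by blast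
      moreover have "vote G M a b1 = (if (b1, b) \<in> pref G a then 1 else - 1)"
        using vote_matched[OF M_matching a] False by simp
      ultimately show ?thesis
        using S_D(11)[OF S] witness_edge[OF M_witness S_D(5)[OF S]] better(2) False \<alpha>
        by (auto split: if_splits)
    qed (use S in blast)
  qed blast
qed

text \<open>Triples excluded from \<open>candidates\<close> by one of its last two clauses do not block \<open>S\<close> either,
  as the end whose clause fails is kept and does better in \<open>S\<close>.\<close>

lemma S_stable':
  assumes ab: "a \<in> men G" "b \<in> women G" "Q a" "Q b" "{a, b} \<in> edges G"
    and t: "- 1 \<le> t" "even (t - s)" "t \<le> 1 \<or> a \<in> C"
  shows "(\<exists>b' t'. (a, b', t') \<in> S \<and> (b' = b \<and> t' = t \<or> t' < t \<or> t' = t \<and> (b', b) \<in> pref G a)) \<or>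
      (\<exists>a' t'. (a', b, t') \<in> S \<and> (a' = a \<and> t' = t \<or> t < t' \<or> t' = t \<and> (a', a) \<in> pref G b))"
proof (cases "(a, b, t) \<in> candidates M \<alpha> s")
  case False
  then consider
      (man) "\<not> (t \<le> - \<alpha> a - 1 \<or> t = 1 - \<alpha> a \<and> 0 \<le> vote G M a b)"
    | (woman) "\<not> (\<alpha> b + 1 \<le> t \<or> t = \<alpha> b - 1 \<and> 0 \<le> vote G M b a)"
    using ab t by (auto simp: candidates_def)
  then show ?thesis
  proof cases
    case man
    \<comment> \<open>\<open>t\<close> has parity \<open>s\<close> and \<open>\<alpha> a\<close> has
      not, so failure of the clause leaves only large \<open>t\<close>.\<close>
    have "t \<noteq> - \<alpha> a" using t(2) ab(3) by (auto simp: off_parity_def)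
    then have t_ge: "1 - \<alpha> a < t \<or> t = 1 - \<alpha> a \<and> vote G M a b < 0" using man by linarith
    have "matched M a \<and> (0 \<le> \<alpha> a \<or> a \<in> C)"
    proof (rule ccontr)
      assume n: "\<not> (matched M a \<and> (0 \<le> \<alpha> a \<or> a \<in> C))"
      then have C: "a \<notin> C" using M_feasible by (auto simp: feasible_matching_def)
      show False
      proof (cases "matched M a")
        case True
        then show False using n C t(3) t_ge by auto
      next
        case False
        then show False using C t(3) t_ge M_unmatched ab(1) by (auto simp: vote_unmatched)
      qed
    qed
    then obtain b' t' where S: "(a, b', t') \<in> S" using man_kept ab by blast
    \<comment> \<open>In \<open>S\<close> the man gets a smaller \<open>t'\<close>, or the same one
      with a nonnegative vote for \<open>b'\<close> against a negative vote for
      \<open>b\<close>.\<close>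
    then show ?thesis
      using S_D(10)[OF S] t_ge vote_less_imp_pref[OF M_matching S_D(5)[OF S] ab(5)] by fastforce
  next
    case woman
    have "t \<noteq> \<alpha> b" using t(2) ab(4) by (auto simp: off_parity_def)
    then have t_le: "t < \<alpha> b - 1 \<or> t = \<alpha> b - 1 \<and> vote G M b a < 0" using woman by linarith
    then have "matched M b"
      using M_unmatched[of b] ab(2) t(1) vote_unmatched[of M b a] by (cases "matched M b") auto
    then obtain a' t' where S: "(a', b, t') \<in> S" using woman_kept ab t(1) t_le by force
    have "{b, a} \<in> edges G" using ab(5) by (simp add: insert_commute)
    then show ?thesis
      using S S_D(11)[OF S] t_le vote_less_imp_pref[OF M_matching S_D(6)[OF S], of a] by fastforce
  qed
qed (rule S_stable)

section \<open>The new matching and its dual values\<close>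

definition N :: "'v set set" where
  "N = {e \<in> M. \<forall>v\<in>e. \<not> Q v} \<union> {{a, b} |a b. \<exists>t. (a, b, t) \<in> S}"

lemma N_I: "(a, b, t) \<in> S \<Longrightarrow> {a, b} \<in> N" "(a, b, t) \<in> S \<Longrightarrow> {b, a} \<in> N"
  by (auto simp: N_def insert_commute)

lemma N_matching: "is_matching G N"
  unfolding is_matching_def
proof
  show "N \<subseteq> edges G" using matching_edge[OF M_matching] S_D(5) by (auto simp: N_def)
  \<comment> \<open>Edges of \<open>S\<close> have both ends off parity and kept edges of
    \<open>M\<close> have none, so edges meeting at \<open>v\<close> come from the same
    part.\<close>
  have "d = e" if de: "d \<in> N" "e \<in> N" and v: "v \<in> d" "v \<in> e" for d e v
  proof (cases "Q v")
    case True
    then obtain a b t a' b' t' where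
      "d = {a, b}" "(a, b, t) \<in> S" "e = {a', b'}" "(a', b', t') \<in> S"
      using de v by (auto simp: N_def)
    then show ?thesis
      using v S_man[of a b t b' t'] S_woman[of a b t a' t'] S_D(1,2)[of a b t] S_D(1,2)[of a' b' t']
        disjoint by auto
  next
    case False
    then have "d \<in> M" "e \<in> M" using de v S_D(3,4) by (auto simp: N_def)
    then show ?thesis
      using v M_matching by (auto simp: is_matching_def pairwise_def disjnt_iff)
  qed
  then show "pairwise disjnt N" by (auto simp: pairwise_def disjnt_iff)
qed

lemma N_Q:
  assumes "Q v" "{v, u} \<in> N"
  shows "\<exists>t. (v, u, t) \<in> S \<or> (u, v, t) \<in> S"
  using assms by (auto simp: N_def doubleton_eq_iff)

lemma N_not_Q: "\<not> Q v \<Longrightarrow> {v, u} \<in> N \<longleftrightarrow> {v, u} \<in> M"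
  using S_D(3,4) Q_pair[of u v] by (auto simp: N_def doubleton_eq_iff insert_commute)

lemma N_not_Q_matched: "\<not> Q v \<Longrightarrow> matched N v \<longleftrightarrow> matched M v"
  using N_not_Q matchedE[OF M_matching] matchedE[OF N_matching] matchedI by metis

lemma vote_N_not_Q: "\<not> Q v \<Longrightarrow> vote G N v u = vote G M v u"
  using N_not_Q[of v] N_not_Q_matched[of v] by (simp add: vote_def partner_def)

definition \<beta> :: "'v \<Rightarrow> int" where
  "\<beta> v = (if \<not> Q v then \<alpha> v
     else if \<exists>b t. (v, b, t) \<in> S then - (THE t. \<exists>b. (v, b, t) \<in> S)
     else if \<exists>a t. (a, v, t) \<in> S then THE t. \<exists>a. (a, v, t) \<in> S
     else 0)"

lemma \<beta>_S:
  assumes "(a, b, t) \<in> S"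
  shows "\<beta> a = - t" "\<beta> b = t"
proof -
  have "(THE t. \<exists>b. (a, b, t) \<in> S) = t" using assms S_man by blast
  then show "\<beta> a = - t" using assms S_D(3) by (auto simp: \<beta>_def)
  have "(THE t. \<exists>a. (a, b, t) \<in> S) = t" using assms S_woman by blast
  moreover have "\<not> (\<exists>b' t. (b, b', t) \<in> S)" using S_D(1) S_D(2)[OF assms] disjoint by blast
  ultimately show "\<beta> b = t" using assms S_D(4) by (auto simp: \<beta>_def)
qed

lemma S_matched: "(a, b, t) \<in> S \<Longrightarrow> matched N a" "(a, b, t) \<in> S \<Longrightarrow> matched N b"
  using N_I matchedI by metis+

lemma \<beta>_unmatched: "v \<in> V \<Longrightarrow> \<not> matched N v \<Longrightarrow> \<beta> v = 0"
  using S_matched N_not_Q_matched[of v] M_unmatched[of v] by (auto simp: \<beta>_def)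

lemma Q_matched_cases:
  assumes "Q v" "matched N v"
  obtains (man) b t where "(v, b, t) \<in> S" | (woman) a t where "(a, v, t) \<in> S"
  using matchedE[OF N_matching assms(2)] N_Q[OF assms(1)] by metis

lemma N_feasible: "feasible_matching G C N"
  unfolding feasible_matching_def
proof (intro conjI ballI N_matching)
  fix v assume v: "v \<in> C"
  then have *: "matched M v" "v \<in> men G"
    using M_feasible critical_men by (auto simp: feasible_matching_def)
  show "matched N v"
  proof (cases "Q v")
    case True
    then obtain b t where "(v, b, t) \<in> S" using man_kept * v by blast
    then show ?thesis by (intro matchedI[OF N_I(1)])
  qed (use * N_not_Q_matched in blast)
qed

lemma vote_mono_if_kept:
  assumes "{v, u} \<in> N" "0 \<le> vote G M v u"
  shows "vote G N v w \<le> vote G M v w"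
proof -
  have v: "v \<in> V" using edge_in_V(1)[OF matching_edge[OF N_matching assms(1)]] .
  show ?thesis
    using vote_matched[OF N_matching assms(1), of w] vote_better[OF M_matching v, of w u] assms(2)
      vote_bounds(1)[of G M v w] by (auto split: if_splits)
qed

text \<open>On an edge between the two parity classes the constraint for \<open>M\<close> has slack at least one;
  this bounds what the off-parity end may use up.\<close>

lemma off_parity_change:
  assumes v: "Q v"
  shows "vote G N v w - \<beta> v \<le> vote G M v w - \<alpha> v + 1"
proof (cases "matched N v")
  case True
  note b = vote_bounds(2)[of G N v w] vote_bounds(1)[of G M v w]
  \<comment> \<open>Either the value grows by at least one, while the vote grows by at most 2, or it
    drops by one and the vote does not grow.\<close>
  from v True show ?thesis
  proof (cases rule: Q_matched_cases)
    case (man b t)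
    then show ?thesis
      using S_D(10)[OF man] \<beta>_S[OF man] vote_mono_if_kept[OF N_I(1)[OF man], of w] b by auto
  next
    case (woman a t)
    then show ?thesis
      using S_D(11)[OF woman] \<beta>_S[OF woman] vote_mono_if_kept[OF N_I(2)[OF woman], of w] b by auto
  qed
next
  case False
  have V: "v \<in> V" using v Q_in_V by blast
  have "v \<notin> C" using False N_feasible by (auto simp: feasible_matching_def)
  \<comment> \<open>If \<open>M\<close> matches \<open>v\<close>, then \<open>\<alpha> v\<close> is
    -1, since otherwise \<open>v\<close> would be kept.\<close>
  have "vote G M v w - \<alpha> v \<ge> 0"
  proof (cases "matched M v")
    case True
    have "\<not> 0 \<le> \<alpha> v"
      using V man_kept[OF _ v True] woman_kept[OF _ v True] False N_I matchedI by (metis UnE)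
    then show ?thesis using M_lower[OF V \<open>v \<notin> C\<close>] vote_bounds(1)[of G M v w] by linarith
  qed (use M_unmatched V in \<open>simp add: vote_unmatched\<close>)
  then show ?thesis using False \<beta>_unmatched[OF V] by (simp add: vote_unmatched)
qed

lemma mixed_edge:
  assumes e: "{u, v} \<in> edges G" and u: "\<not> Q u" and v: "Q v"
  shows "vote G N u v + vote G N v u \<le> \<beta> u + \<beta> v"
proof -
  have "u \<in> V" using edge_in_V e by blast
  then have "odd (\<alpha> u + \<alpha> v)" using u v by (auto simp: off_parity_def)
  then have "vote G M u v + vote G M v u \<noteq> \<alpha> u + \<alpha> v"
    using vote_sum_even[OF M_matching] by metis
  then have "vote G M u v + vote G M v u + 1 \<le> \<alpha> u + \<alpha> v"
    using witness_edge[OF M_witness e] by linarith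
  then show ?thesis
    using off_parity_change[OF v, of u] vote_N_not_Q[OF u, of v] u by (simp add: \<beta>_def)
qed

lemma off_parity_edge:
  assumes ab: "a \<in> men G" "b \<in> women G" "Q a" "Q b" "{a, b} \<in> edges G"
  shows "vote G N a b + vote G N b a \<le> \<beta> a + \<beta> b"
proof -
  note vb = vote_bounds(2)[of G N a b] vote_bounds(2)[of G N b a]
  have V: "a \<in> V" "b \<in> V" using ab by auto
  have vote_a: "vote G N a b = (if b = b1 then 0 else if (b, b1) \<in> pref G a then 1 else - 1)"
    if "(a, b1, t) \<in> S" for b1 t using vote_matched[OF N_matching N_I(1)[OF that]] .
  have vote_b: "vote G N b a = (if a = a1 then 0 else if (a, a1) \<in> pref G b then 1 else - 1)"
    if "(a1, b, t) \<in> S" for a1 t using vote_matched[OF N_matching N_I(2)[OF that]] .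
  have vote_a': "vote G N a b = - 1" if "(a, b1, t) \<in> S" "(b1, b) \<in> pref G a" for b1 t
    using vote_a[OF that(1)] pref_asym[OF V(1) that(2)] pref_irrefl[OF V(1)] that(2) by auto
  have vote_b': "vote G N b a = - 1" if "(a1, b, t) \<in> S" "(a1, a) \<in> pref G b" for a1 t
    using vote_b[OF that(1)] pref_asym[OF V(2) that(2)] pref_irrefl[OF V(2)] that(2) by auto
  consider (man) "\<not> matched N a" | (woman) "matched N a" "\<not> matched N b"
    | (both) "matched N a" "matched N b" by blast
  then show ?thesis
  proof cases
    case man
    have none: "(a, b1, t) \<notin> S" for b1 t using man N_I(1) matchedI by metis
    \<comment> \<open>Testing stability at \<open>t = s\<close> gives \<open>b\<close> the value
      \<open>s\<close> with a man she prefers, or at least \<open>s + 2\<close>; both make up for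
      the vote 1 of \<open>a\<close>, whose value is 0.\<close>
    have "- 1 \<le> s" "s \<le> 1 \<or> a \<in> C" using s01 by auto
    then obtain a1 t where S: "(a1, b, t) \<in> S" and t: "s < t \<or> t = s \<and> (a1, a) \<in> pref G b"
      using S_stable'[OF ab, of s] none by auto
    have "t = s \<or> s + 2 \<le> t" using t S_D(8)[OF S] by presburger
    then show ?thesis
      using t \<beta>_S(2)[OF S] \<beta>_unmatched[OF V(1) man] vote_b'[OF S] vb s01 by auto
  next
    case woman
    have none: "(a1, b, t) \<notin> S" for a1 t using woman N_I(2) matchedI by metis
    \<comment> \<open>For a missing woman the test is at \<open>t = - s\<close>: by parity and the
      bound -1, no triple has a smaller \<open>t\<close>.\<close>
    have "- 1 \<le> - s" "- s \<le> 1 \<or> a \<in> C" using s01 by auto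
    then obtain b1 t where S: "(a, b1, t) \<in> S" and t: "t < - s \<or> t = - s \<and> (b1, b) \<in> pref G a"
      using S_stable'[OF ab, of "- s"] none by auto
    have "t = - s" using t S_D(7,8)[OF S] s01 by presburger
    then show ?thesis
      using t \<beta>_S(1)[OF S] \<beta>_unmatched[OF V(2) woman(2)] vote_a'[OF S] vb s01 by auto
  next
    case both
    obtain b1 t where Sa: "(a, b1, t) \<in> S"
      using Q_matched_cases[OF ab(3) both(1)] S_D(2) ab(1) disjoint by metis
    obtain a1 t' where Sb: "(a1, b, t') \<in> S"
      using Q_matched_cases[OF ab(4) both(2)] S_D(1) ab(2) disjoint by metis
    have \<beta>: "\<beta> a = - t" "\<beta> b = t'" using \<beta>_S Sa Sb by auto
    have b1: "b1' = b1 \<and> r = t" if "(a, b1', r) \<in> S" for b1' r using S_man[OF that Sa] .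
    have a1: "a1' = a1 \<and> r = t'" if "(a1', b, r) \<in> S" for a1' r using S_woman[OF that Sb] .
    have same: "t = t' \<and> a1 = a" if "b1 = b" using a1 Sa that by blast
    have same': "t = t' \<and> b1 = b" if "a1 = a" using b1 Sb that by blast
    have at_t: "b1 = b \<or> (b1, b) \<in> pref G a \<or> (a1 = a \<and> t' = t) \<or> t < t' \<or> t' = t \<and> (a1, a) \<in> pref G b"
      using S_stable'[OF ab S_D(7-9)[OF Sa]] a1 b1 by (metis less_irrefl)
    have parity: "even (t - t')" using S_D(8)[OF Sa] S_D(8)[OF Sb] by presburger
    consider "t < t'" | "t = t'" | "t' < t" by linarith
    then show ?thesis
    proof cases
      case 1
      then have "t + 2 \<le> t'" using parity by presburger
      then show ?thesis using \<beta> vb by linarith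
    next
      case 2
      show ?thesis
      proof (cases "b1 = b")
        case True
        then show ?thesis using same vote_a[OF Sa] vote_b[OF Sb] \<beta> by simp
      next
        case False
        then have "(b1, b) \<in> pref G a \<or> (a1, a) \<in> pref G b" using at_t same' 2 by blast
        then show ?thesis using vote_a'[OF Sa] vote_b'[OF Sb] \<beta> vb 2 by linarith
      qed
    next
      case 3
      then have le: "t' \<le> t - 2" using parity by presburger
      have "b1 \<noteq> b" "a1 \<noteq> a" using same same' 3 by auto
      then have "(b1, b) \<in> pref G a" using at_t 3 by simp
      \<comment> \<open>At \<open>t - 2\<close> the man would gain, so the woman must refuse: she
        has the value \<open>t - 2\<close> and prefers \<open>a1\<close>. Two votes of -1 then match
        the difference of the values.\<close>
      have "t' = t - 2 \<and> (a1, a) \<in> pref G b"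
      proof -
        have "- 1 \<le> t - 2" "even (t - 2 - s)" "t - 2 \<le> 1 \<or> a \<in> C"
          using S_D(7)[OF Sb] S_D(8,9)[OF Sa] le by auto
        from S_stable'[OF ab this] show ?thesis
        proof (elim disjE[of "\<exists>b' t'. _ b' t'"] exE conjE)
          fix b' r assume "(a, b', r) \<in> S" "b' = b \<and> r = t - 2 \<or> r < t - 2 \<or> r = t - 2 \<and> (b', b) \<in> pref G a"
          then show ?thesis using b1[of b' r] by simp
        next
          fix a' r assume "(a', b, r) \<in> S" "a' = a \<and> r = t - 2 \<or> t - 2 < r \<or> r = t - 2 \<and> (a', a) \<in> pref G b"
          then show ?thesis using a1[of a' r] \<open>a1 \<noteq> a\<close> le by auto
        qed
      qed
      then show ?thesis
        using vote_a'[OF Sa \<open>(b1, b) \<in> pref G a\<close>] vote_b'[OF Sb] \<beta> by auto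
    qed
  qed
qed

text \<open>Edges are sorted by how many ends are off parity; with none, votes and values are
  unchanged. The lower bounds off \<open>C\<close> come from the range of \<open>t\<close> in
  \<open>candidates\<close>.\<close>

lemma N_witness: "witness G C N \<beta>"
  unfolding witness_def
proof (intro conjI allI ballI impI)
  fix a b assume e: "{a, b} \<in> edges G"
  then have e': "{b, a} \<in> edges G" by (simp add: insert_commute)
  show "vote G N a b + vote G N b a \<le> \<beta> a + \<beta> b"
  proof (cases "Q a"; cases "Q b")
    assume "Q a" "Q b"
    then show ?thesis
      using off_parity_edge[of a b] off_parity_edge[of b a] e e' edge_ends[OF e] by auto
  next
    assume "\<not> Q a" "\<not> Q b"
    then show ?thesis using witness_edge[OF M_witness e] by (simp add: vote_N_not_Q \<beta>_def)
  qed (use mixed_edge[OF e] mixed_edge[OF e'] in auto)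
next
  fix a b assume e: "{a, b} \<in> N"
  show "\<beta> a + \<beta> b = 0"
  proof (cases "Q a")
    case True
    then show ?thesis using N_Q[OF _ e] \<beta>_S by fastforce
  next
    case False
    then have "{a, b} \<in> M" using e N_not_Q by blast
    moreover from this have "\<not> Q b" using False Q_pair[of b a] by (auto simp: insert_commute)
    ultimately show ?thesis using False M_pair by (simp add: \<beta>_def)
  qed
next
  fix v assume v: "v \<in> V - C"
  show "- 1 \<le> \<beta> v"
  proof (cases "Q v \<and> matched N v")
    case True
    then have "Q v" "matched N v" by auto
    then show ?thesis
    proof (cases rule: Q_matched_cases)
      case (man b t)
      then show ?thesis using \<beta>_S[OF man] S_D(9)[OF man] v by auto
    next
      case (woman a t)
      then show ?thesis using \<beta>_S[OF woman] S_D(7)[OF woman] by auto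
    qed
  next
    case False
    have "\<beta> v = 0" if "Q v" using \<beta>_unmatched[of v] v False that by blast
    moreover have "\<beta> v = \<alpha> v" if "\<not> Q v" using that by (simp add: \<beta>_def)
    ultimately show ?thesis using v M_lower[of v] by fastforce
  qed
qed (rule \<beta>_unmatched)

text \<open>Unmatched vertices have value 0, which has the wrong parity for \<open>s = 1\<close>;
  hence the restriction to matched ones.\<close>

lemma \<beta>_parity:
  assumes "v \<in> V" "matched N v"
  shows "even (\<beta> v - s)"
proof (cases "Q v")
  case True
  from True assms(2) show ?thesis
  proof (cases rule: Q_matched_cases)
    case (man b t)
    then show ?thesis using \<beta>_S(1)[OF man] S_D(8)[OF man] by simp
  next
    case (woman a t)
    then show ?thesis using \<beta>_S(2)[OF woman] S_D(8)[OF woman] by simp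
  qed
next
  case False
  then have "\<beta> v = \<alpha> v" by (simp add: \<beta>_def)
  then show ?thesis using assms False by (simp add: off_parity_def)
qed

end

section \<open>Existence of the exchange for either parity\<close>

context critical_marriage begin

lemma exchange_exists:
  assumes "feasible_matching G C M" "witness G C M \<alpha>" "s = 0 \<or> s = 1"
  obtains S where "exchange G C M \<alpha> s S"
proof -
  let ?X = "candidates M \<alpha> s"
  define f :: "'v \<times> 'v \<times> int \<Rightarrow> 'v" where "f = fst"
  define g :: "'v \<times> 'v \<times> int \<Rightarrow> 'v" where "g = fst \<circ> snd"
  define P :: "'v \<times> 'v \<times> int \<Rightarrow> 'v \<times> 'v \<times> int \<Rightarrow> bool" where
    "P = (\<lambda>(a, b, t) (a', b', t'). t < t' \<or> t = t' \<and> (b, b') \<in> pref G a)"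
  define R :: "'v \<times> 'v \<times> int \<Rightarrow> 'v \<times> 'v \<times> int \<Rightarrow> bool" where
    "R = (\<lambda>(a, b, t) (a', b', t'). t' < t \<or> t = t' \<and> (a, a') \<in> pref G b)"
  have "finite ?X"
  proof (rule finite_subset)
    \<comment> \<open>The man's clause bounds \<open>t\<close> by \<open>1 - \<alpha> a\<close>,
      leaving finitely many copies of each edge.\<close>
    show "?X \<subseteq> (SIGMA a : V. V \<times> {- 1..1 - \<alpha> a})" by (auto simp: candidates_def)
    show "finite (SIGMA a : V. V \<times> {- 1..1 - \<alpha> a})"
      by (intro finite_SigmaI finite_V finite_cartesian_product) simp
  qed
  then have "\<exists>S \<subseteq> ?X. inj_on f S \<and> inj_on g S \<and>
    (\<forall>x\<in>?X. (\<exists>y\<in>S. f y = f x \<and> (y = x \<or> P y x)) \<or> (\<exists>y\<in>S. g y = g x \<and> (y = x \<or> R y x)))"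
  proof (rule stable_matching_exists)
    fix x y assume xy: "x \<in> ?X" "y \<in> ?X"
    obtain a b t a' b' t' where eq: "x = (a, b, t)" "y = (a', b', t')" by (metis prod_cases3)
    have e: "{a, b} \<in> edges G" "{a', b'} \<in> edges G" "{b, a} \<in> edges G" "{b', a'} \<in> edges G"
      using xy eq by (auto simp: candidates_def insert_commute)
    show "f x = f y \<Longrightarrow> x = y \<or> P x y \<or> P y x"
      using pref_total e by (auto simp: f_def P_def eq)
    show "g x = g y \<Longrightarrow> x = y \<or> R x y \<or> R y x"
      using pref_total e by (auto simp: g_def R_def eq)
  next
    fix x y z assume xyz: "x \<in> ?X" "y \<in> ?X" "z \<in> ?X"
    obtain a b t a' b' t' c d r where eq: "x = (a, b, t)" "y = (a', b', t')" "z = (c, d, r)"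
      by (metis prod_cases3)
    have v: "a \<in> V" "b \<in> V" using xyz eq by (auto simp: candidates_def)
    show "f x = f y \<Longrightarrow> f y = f z \<Longrightarrow> P x y \<Longrightarrow> P y z \<Longrightarrow> P x z"
      using pref_trans[OF v(1), of b b' d] by (auto simp: f_def P_def eq)
    show "g x = g y \<Longrightarrow> g y = g z \<Longrightarrow> R x y \<Longrightarrow> R y z \<Longrightarrow> R x z"
      using pref_trans[OF v(2), of a a' c] by (auto simp: g_def R_def eq)
  next
    fix x assume "x \<in> ?X"
    then show "\<not> P x x" using pref_irrefl by (auto simp: P_def candidates_def)
  qed
  then obtain S where S: "S \<subseteq> ?X" "inj_on f S" "inj_on g S"
    "\<And>x. x \<in> ?X \<Longrightarrow>
      (\<exists>y\<in>S. f y = f x \<and> (y = x \<or> P y x)) \<or> (\<exists>y\<in>S. g y = g x \<and> (y = x \<or> R y x))"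
    by blast
  have "exchange G C M \<alpha> s S"
  proof (unfold_locales, goal_cases)
    case (5 a b t b' t')
    then show ?case using inj_onD[OF S(2) _ 5] by (simp add: f_def)
  next
    case (6 a b t a' t')
    then show ?case using inj_onD[OF S(3) _ 6] by (simp add: g_def)
  next
    case (7 a b t)
    from S(4)[OF 7] show ?case
    proof (elim disjE[of "\<exists>y\<in>S. f y = _ \<and> _ y"] bexE)
      fix y assume "y \<in> S" "f y = f (a, b, t) \<and> (y = (a, b, t) \<or> P y (a, b, t))"
      then show ?case by (intro disjI1) (cases y, auto simp: f_def P_def)
    next
      fix y assume "y \<in> S" "g y = g (a, b, t) \<and> (y = (a, b, t) \<or> R y (a, b, t))"
      then show ?case by (intro disjI2) (cases y, auto simp: g_def R_def)
    qed
  qed (use assms S(1) in auto)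
  then show thesis by (rule that)
qed

lemma single_parity_witness_exists:
  assumes M: "feasible_matching G C M" "witness G C M \<alpha>" and s: "s = 0 \<or> s = 1"
  obtains N \<beta> where "feasible_matching G C N" "witness G C N \<beta>"
    and "\<And>e. e \<in> M \<Longrightarrow> (\<And>v. v \<in> e \<Longrightarrow> even (\<alpha> v - s)) \<Longrightarrow> e \<in> N"
    and "\<And>v. v \<in> V \<Longrightarrow> matched N v \<Longrightarrow> even (\<beta> v - s)"
proof -
  obtain S where "exchange G C M \<alpha> s S" using exchange_exists[OF assms] .
  then interpret exchange G C M \<alpha> s S .
  show thesis
    by (rule that[OF N_feasible N_witness _ \<beta>_parity]) (auto simp: N_def off_parity_def)
qed

end

theorem mainTheorem2:
  fixes G :: "'v marriage" and C :: "'v set" and e :: "'v set"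
  assumes "marriage_instance G"
    and "C \<subseteq> men G"
    and "e \<in> edges G"
  shows "(\<exists>M. popular_feasible G C M \<and> e \<in> M) \<longleftrightarrow>
    (\<exists>M. min_size_popular_feasible G C M \<and> e \<in> M) \<or>
    (\<exists>M. dominant_feasible G C M \<and> e \<in> M)"
proof
  interpret critical_marriage G C using assms by unfold_locales
  assume "\<exists>M. popular_feasible G C M \<and> e \<in> M"
  then obtain M where pop: "popular_feasible G C M" and e: "e \<in> M" by blast
  then obtain \<alpha> where \<alpha>: "witness G C M \<alpha>" using witness_exists by blast
  have M: "feasible_matching G C M" using pop by (simp add: popular_feasible_def)
  obtain a b where ab: "e = {a, b}" using edgeE[OF assms(3)] by blast
  then have "\<alpha> a + \<alpha> b = 0" using \<alpha> e by (simp add: witness_def)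
  \<comment> \<open>Opposite values have equal parity, so one of the choices \<open>s = 0\<close>
    and \<open>s = 1\<close> keeps \<open>e\<close>.\<close>
  then have parity: "even (\<alpha> b - \<alpha> a)" by presburger
  show "(\<exists>M. min_size_popular_feasible G C M \<and> e \<in> M) \<or> (\<exists>M. dominant_feasible G C M \<and> e \<in> M)"
  proof (cases "even (\<alpha> a)")
    case True
    obtain N \<beta> where N: "feasible_matching G C N" "witness G C N \<beta>"
      "\<And>e. e \<in> M \<Longrightarrow> (\<And>v. v \<in> e \<Longrightarrow> even (\<alpha> v - 0)) \<Longrightarrow> e \<in> N"
      "\<And>v. v \<in> V \<Longrightarrow> matched N v \<Longrightarrow> even (\<beta> v - 0)"
      using single_parity_witness_exists[OF M \<alpha>, of 0] by auto
    \<comment> \<open>Unmatched vertices have value 0, so here all values are even.\<close>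
    have "even (\<beta> v)" if "v \<in> V" for v
      using N(2) N(4)[OF that] that by (cases "matched N v") (auto simp: witness_def)
    then have "min_size_popular_feasible G C N" by (rule min_size_if_even_witness[OF N(1,2)])
    moreover have "e \<in> N" using N(3)[OF e] ab True parity by auto
    ultimately show ?thesis by blast
  next
    case False
    obtain N \<beta> where N: "feasible_matching G C N" "witness G C N \<beta>"
      "\<And>e. e \<in> M \<Longrightarrow> (\<And>v. v \<in> e \<Longrightarrow> even (\<alpha> v - 1)) \<Longrightarrow> e \<in> N"
      "\<And>v. v \<in> V \<Longrightarrow> matched N v \<Longrightarrow> even (\<beta> v - 1)"
      using single_parity_witness_exists[OF M \<alpha>, of 1] by auto
    have "odd (\<beta> v)" if "v \<in> V" "matched N v" for v using N(4)[OF that] by simp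
    then have "dominant_feasible G C N" by (rule dominant_if_odd_witness[OF N(1,2)])
    moreover have "e \<in> N" using N(3)[OF e] ab False parity by auto
    ultimately show ?thesis by blast
  qed
qed (auto simp: min_size_popular_feasible_def dominant_feasible_def)

end
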